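(* For each $f\in BM_+(\mathcal{W})$ and each nonnegative or integrable measurable function $g$ on $(\mathcal{M},\mathcal{B}(\mathcal{M}))$, $$\int_{\mathcal{M}} g(N)e^{-N(f)}\,\mathcal{P}(dN|\nu)=\mathcal{L}_N(f|\nu)\int_{\mathcal{M}} g(N)\,\mathcal{P}(dN|e^{-f}\nu),$$ where $\mathcal{P}(dN|e^{-f}\nu)$ is the law of a Poisson random measure with mean intensity $e^{-f(w)}\nu(dw)$. In other words, $e^{-N(f)}\mathcal{P}(dN|\nu)=\mathcal{L}_N(f|\nu)\,\mathcal{P}(dN|e^{-f}\nu)$ as measures on $\mathcal{M}$. The result extends to any nonnegative measurable $f$ on $\mathcal{W}$ such that $\int_{\mathcal{W}}(1-e^{-f(w)})\,\nu(dw)<\infty$.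
   Context: $\mathcal{W}$ is an arbitrary Polish space (with a fixed complete separable metric, which determines the bounded sets). $\mathcal{M}$ is the space of boundedly finite Borel measures on $\mathcal{W}$ (finite on bounded Borel sets) with its usual sigma-field $\mathcal{B}(\mathcal{M})$. $\nu$ is a nonatomic sigma-finite measure on $\mathcal{W}$ with $\nu(B)<\infty$ for every bounded Borel set $B$. $\mathcal{P}(dN|\nu)$ denotes the law on $\mathcal{M}$ of a Poisson random measure $N$ with mean intensity $E[N(dw)]=\nu(dw)$. $BM_+(\mathcal{W})$ is the class of nonnegative Borel measurable functions on $\mathcal{W}$ of bounded support. $N(f)=\int_{\mathcal{W}}f(w)\,N(dw)$, and $$\mathcal{L}_N(f|\nu)=\int_{\mathcal{M}}e^{-N(f)}\,\mathcal{P}(dN|\nu)=\exp\Big(-\int_{\mathcal{W}}(1-e^{-f(w)})\,\nu(dw)\Big)$$ is the Laplace functional of $N$. *)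

theory Defs
  imports "HOL-Probability.Probability"
begin

(* An atom-free measure in the general measure-theoretic sense: every measurable set of
   positive measure has a measurable subset of strictly intermediate measure. *)
definition nonatomic :: "'a measure \<Rightarrow> bool" where
  "nonatomic M \<longleftrightarrow>
     (\<forall>A\<in>sets M. 0 < emeasure M A \<longrightarrow>
        (\<exists>B\<in>sets M. B \<subseteq> A \<and> 0 < emeasure M B \<and> emeasure M B < emeasure M A))"

definition boundedly_finite_measures :: "'w::polish_space measure set" where
  "boundedly_finite_measures =
     {m. sets m = sets borel \<and> (\<forall>B\<in>sets borel. bounded B \<longrightarrow> emeasure m B < \<infinity>)}"

(* The space of boundedly finite measures, with the sigma-field generated by the
   evaluations m \<mapsto> m(B), B Borel. As a measure it only carries this measurable space. *)
definition bf_algebra :: "'w::polish_space measure measure" where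
  "bf_algebra =
     sigma boundedly_finite_measures
       {{m\<in>boundedly_finite_measures. emeasure m B \<in> A} | B A. B \<in> sets borel \<and> A \<in> sets borel}"

lemma space_bf_algebra [simp]: "space bf_algebra = boundedly_finite_measures"
  unfolding bf_algebra_def by (rule space_measure_of) auto

lemma measurable_emeasure_bf_algebra [measurable]:
  assumes "B \<in> sets borel"
  shows "(\<lambda>m. emeasure m B) \<in> borel_measurable bf_algebra"
proof (rule measurableI)
  fix A :: "ennreal set"
  assume A: "A \<in> sets borel"
  have "(\<lambda>m. emeasure m B) -` A \<inter> space bf_algebra
        = {m\<in>boundedly_finite_measures. emeasure m B \<in> A}"
    by auto
  also have "\<dots> \<in> sets bf_algebra"
    unfolding bf_algebra_def using A assms by (subst sets_measure_of) auto
  finally show "(\<lambda>m. emeasure m B) -` A \<inter> space bf_algebra \<in> sets bf_algebra" .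
qed simp

(* N is a Poisson random measure on the probability space \<Omega> with mean intensity \<nu>.
   The Poisson probabilities are spelled out because poisson_pmf requires a positive rate,
   whereas \<nu>(B) = 0 is allowed here (then N(B) = 0 almost surely, as 0 ^ 0 = 1). *)
definition poisson_random_measure ::
  "'b measure \<Rightarrow> ('b \<Rightarrow> 'w::polish_space measure) \<Rightarrow> 'w measure \<Rightarrow> bool" where
  "poisson_random_measure \<Omega> N \<nu> \<longleftrightarrow>
     prob_space \<Omega> \<and>
     N \<in> measurable \<Omega> bf_algebra \<and>
     (\<forall>B\<in>sets borel. bounded B \<longrightarrow>
        (\<forall>k::nat. measure \<Omega> {\<omega>\<in>space \<Omega>. emeasure (N \<omega>) B = of_nat k}
                  = measure \<nu> B ^ k / fact k * exp (- measure \<nu> B))) \<and>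
     (\<forall>(n::nat) (B :: nat \<Rightarrow> 'w set).
        (\<forall>i<n. B i \<in> sets borel \<and> bounded (B i)) \<and> disjoint_family_on B {..<n} \<longrightarrow>
        prob_space.indep_vars \<Omega> (\<lambda>_. borel) (\<lambda>i \<omega>. emeasure (N \<omega>) (B i)) {..<n})"

(* P is the law P(dN | \<nu>): a probability on the space of boundedly finite measures under
   which the canonical element N is a Poisson random measure with mean intensity \<nu>. *)
definition poisson_law :: "'w::polish_space measure \<Rightarrow> 'w measure measure \<Rightarrow> bool" where
  "poisson_law \<nu> P \<longleftrightarrow> sets P = sets bf_algebra \<and> poisson_random_measure P (\<lambda>N. N) \<nu>"

definition BM_plus :: "('w::polish_space \<Rightarrow> real) set" where
  "BM_plus = {f \<in> borel_measurable borel. (\<forall>w. 0 \<le> f w) \<and> bounded {w. f w \<noteq> 0}}"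

(* exp (- N(f)), with N(f) the [0,\<infinity>]-valued integral of a nonnegative f and
   exp (- \<infinity>) = 0. The Bochner integral would wrongly give N(f) = 0 when N(f) = \<infinity>. *)
definition exp_neg_integral :: "('w \<Rightarrow> real) \<Rightarrow> 'w measure \<Rightarrow> real" where
  "exp_neg_integral f N =
     (let Nf = (\<integral>\<^sup>+ w. ennreal (f w) \<partial>N) in if Nf = \<infinity> then 0 else exp (- enn2real Nf))"

definition laplace_functional :: "'w measure measure \<Rightarrow> ('w \<Rightarrow> real) \<Rightarrow> real" where
  "laplace_functional P f = (\<integral>N. exp_neg_integral f N \<partial>P)"

end

theory Submission
  imports Defs
begin

text \<open>
  The Laplace functional of a Poisson random measure, \<open>E exp (- N u) = exp (- \<integral>(1 - exp (- u)) d\<nu>)\<close>,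
  is computed for simple \<open>u\<close> of bounded support by independence and for all measurable
  \<open>u \<ge> 0\<close> by monotone limits. The identity
  \<open>1 - exp (- f - u) = (1 - exp (- f)) + exp (- f) (1 - exp (- u))\<close>
  then shows that \<open>exp (- N f) P(dN | \<nu>)\<close> and \<open>L(f) P(dN | exp (- f) \<nu>)\<close> have the same Laplace
  functional, and a finite measure on the space of boundedly finite measures is determined by
  its Laplace functional. For the last point, the indicator of \<open>N B > a\<close> is a bounded pointwise limit of
  polynomials in the functions \<open>exp (- n N B)\<close>, and such events generate the sigma-field.
\<close>

section \<open>The map exp (- x) on [0,\<infinity>]\<close>

text \<open>The value 0 at \<infinity> makes the map continuous and multiplicative on all of
  [0,\<infinity>], so sums and limits of possibly infinite integrals pass through it. It is
  real-valued so that Bochner integrals and dominated convergence apply.\<close>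

definition exp_neg :: "ennreal \<Rightarrow> real" where
  "exp_neg x = (if x = \<infinity> then 0 else exp (- enn2real x))"

lemma exp_neg_ennreal [simp]: "0 \<le> x \<Longrightarrow> exp_neg (ennreal x) = exp (- x)"
  by (simp add: exp_neg_def)

lemma exp_neg_top [simp]: "exp_neg \<top> = 0"
  by (simp add: exp_neg_def)

lemma exp_neg_0 [simp]: "exp_neg 0 = 1"
  by (simp add: exp_neg_def)

lemma exp_neg_nonneg [simp]: "0 \<le> exp_neg x"
  by (simp add: exp_neg_def)

lemma exp_neg_le_1 [simp]: "exp_neg x \<le> 1"
  by (simp add: exp_neg_def)

lemma exp_neg_add: "exp_neg (x + y) = exp_neg x * exp_neg y"
  by (cases x; cases y) (simp_all add: exp_add[symmetric] ennreal_plus[symmetric] del: ennreal_plus)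

lemma exp_neg_sum: "exp_neg (\<Sum>i\<in>I. x i) = (\<Prod>i\<in>I. exp_neg (x i))"
  by (induction I rule: infinite_finite_induct) (simp_all add: exp_neg_add)

lemma exp_neg_of_nat_mult: "exp_neg (x * of_nat k) = exp_neg x ^ k"
  by (induction k) (simp_all add: exp_neg_add distrib_left)

text \<open>Near a finite limit \<open>X i\<close> is eventually finite and the real exponential is
  continuous; at \<infinity> the values fall below every positive bound. The arbitrary filter serves
  both for sequences and for the continuity that yields Borel measurability.\<close>

lemma tendsto_exp_neg:
  assumes "(X \<longlongrightarrow> x) F"
  shows "((\<lambda>i. exp_neg (X i)) \<longlongrightarrow> exp_neg x) F"
proof (cases x)
  case (real r)
  have "eventually (\<lambda>i. X i < \<top>) F"
    using assms real by (intro order_tendstoD(2)[OF assms]) simp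
  moreover have "((\<lambda>i. exp (- enn2real (X i))) \<longlongrightarrow> exp (- r)) F"
    using assms real by (intro tendsto_intros) auto
  ultimately show ?thesis
    using real by (auto simp: exp_neg_def elim!: Lim_transform_eventually eventually_mono)
next
  case top
  show ?thesis
  proof (rule tendstoI)
    fix e :: real assume "0 < e"
    \<comment> \<open>For r > - ln e one has exp (- r) < e; the maximum with 0 keeps
      \<open>l\<close> nonnegative, so that \<open>ennreal l\<close> represents it
      faithfully.\<close>
    define l where "l = max 0 (- ln e)"
    have "0 \<le> l" by (simp add: l_def)
    have "eventually (\<lambda>i. ennreal l < X i) F"
      using assms top \<open>0 \<le> l\<close> by (simp add: tendsto_top_iff_ennreal)
    then show "eventually (\<lambda>i. dist (exp_neg (X i)) (exp_neg x) < e) F"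
    proof eventually_elim
      case (elim i)
      show ?case
      proof (cases "X i")
        case (real r)
        with elim \<open>0 \<le> l\<close> have "l < r" by (simp add: ennreal_less_iff)
        then have "- ln e < r" by (simp add: l_def)
        then have "exp (- r) < exp (ln e)" by simp
        with real top \<open>0 < e\<close> show ?thesis by (simp add: dist_real_def)
      qed (use top \<open>0 < e\<close> in simp)
    qed
  qed
qed

lemma borel_measurable_exp_neg [measurable]: "exp_neg \<in> borel_measurable borel"
  by (intro borel_measurable_continuous_onI) (auto simp: continuous_on_def intro!: tendsto_exp_neg)

lemma exp_neg_antimono: "x \<le> y \<Longrightarrow> exp_neg y \<le> exp_neg x"
  by (auto simp: exp_neg_def top_unique less_top[symmetric] intro!: enn2real_mono)

lemma exp_neg_integral_eq: "exp_neg_integral f N = exp_neg (\<integral>\<^sup>+ w. ennreal (f w) \<partial>N)"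
  by (simp add: exp_neg_integral_def exp_neg_def Let_def)

lemma exp_neg_integral_bounds: "0 \<le> exp_neg_integral f N" "exp_neg_integral f N \<le> 1"
  by (simp_all add: exp_neg_integral_eq)

section \<open>Measurability on the space of boundedly finite measures\<close>

lemma sets_boundedly_finite [measurable_cong]: "m \<in> boundedly_finite_measures \<Longrightarrow> sets m = sets borel"
  by (simp add: boundedly_finite_measures_def)

lemma borel_measurable_boundedly_finite:
  "m \<in> boundedly_finite_measures \<Longrightarrow> u \<in> borel_measurable borel \<Longrightarrow> u \<in> borel_measurable m"
  by (simp cong: measurable_cong_sets add: sets_boundedly_finite)

text \<open>Induction over nonnegative Borel functions, starting from the evaluations that generate
  the sigma-field. The integral rules need measurability with respect to \<open>m\<close>, which is
  known for \<open>m\<close> in the space of \<open>bf_algebra\<close>; hence the use of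
  \<open>measurable_cong\<close> in each case.\<close>

lemma measurable_nn_integral_bf_algebra [measurable]:
  assumes "u \<in> borel_measurable (borel :: 'w::polish_space measure)"
  shows "(\<lambda>m. \<integral>\<^sup>+ w. u w \<partial>m) \<in> borel_measurable (bf_algebra :: 'w measure measure)"
  using assms
proof induct
  case (cong f g)
  moreover have "(\<lambda>m. \<integral>\<^sup>+ w. f w \<partial>m) \<in> borel_measurable bf_algebra \<longleftrightarrow>
      (\<lambda>m. \<integral>\<^sup>+ w. g w \<partial>m) \<in> borel_measurable bf_algebra"
    by (intro measurable_cong nn_integral_cong cong) auto
  ultimately show ?case by simp
next
  case (set B)
  then have "(\<lambda>m. \<integral>\<^sup>+ w. indicator B w \<partial>m) \<in> borel_measurable bf_algebra \<longleftrightarrow>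
      (\<lambda>m. emeasure m B) \<in> borel_measurable (bf_algebra :: 'w measure measure)"
    by (intro measurable_cong nn_integral_indicator) (simp add: sets_boundedly_finite)
  with set show ?case by simp
next
  case (mult f c)
  then have "(\<lambda>m. \<integral>\<^sup>+ w. c * f w \<partial>m) \<in> borel_measurable bf_algebra \<longleftrightarrow>
      (\<lambda>m. c * \<integral>\<^sup>+ w. f w \<partial>m) \<in> borel_measurable (bf_algebra :: 'w measure measure)"
    by (intro measurable_cong nn_integral_cmult) (simp add: borel_measurable_boundedly_finite)
  with mult show ?case by simp
next
  case (add f g)
  then have "(\<lambda>m. \<integral>\<^sup>+ w. g w + f w \<partial>m) \<in> borel_measurable bf_algebra \<longleftrightarrow>
      (\<lambda>m. (\<integral>\<^sup>+ w. g w \<partial>m) + \<integral>\<^sup>+ w. f w \<partial>m) \<in> borel_measurable (bf_algebra :: 'w measure measure)"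
    by (intro measurable_cong nn_integral_add) (simp_all add: borel_measurable_boundedly_finite)
  with add show ?case by simp
next
  case (seq F)
  then have "(\<lambda>m. \<integral>\<^sup>+ w. (SUP i. F i) w \<partial>m) \<in> borel_measurable bf_algebra \<longleftrightarrow>
      (\<lambda>m. SUP i. \<integral>\<^sup>+ w. F i w \<partial>m) \<in> borel_measurable (bf_algebra :: 'w measure measure)"
    unfolding SUP_apply
    by (intro measurable_cong nn_integral_monotone_convergence_SUP)
       (simp_all add: borel_measurable_boundedly_finite)
  with seq show ?case by (simp add: ac_simps)
qed

section \<open>The Laplace functional of a Poisson random measure\<close>

text \<open>The level set of 0 drops out because \<open>F 0 = 0\<close>; for \<open>u\<close> of
  bounded support the remaining level sets are bounded. The free \<open>F\<close> lets one
  decomposition serve for both N(u) and \<integral>(1 - exp (- u)) d\<nu>.\<close>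

lemma nn_integral_finite_range:
  fixes F :: "'b::zero \<Rightarrow> ennreal"
  assumes "finite (range u)" "\<And>y. u -` {y} \<in> sets M" "F 0 = 0"
  shows "(\<integral>\<^sup>+ w. F (u w) \<partial>M) = (\<Sum>y\<in>range u - {0}. F y * emeasure M (u -` {y}))"
proof -
  have "(\<integral>\<^sup>+ w. F (u w) \<partial>M) = (\<integral>\<^sup>+ w. (\<Sum>y\<in>range u - {0}. F y * indicator (u -` {y}) w) \<partial>M)"
  proof (intro nn_integral_cong)
    fix w
    have "(\<Sum>y\<in>range u - {0}. F y * indicator (u -` {y}) w) = (\<Sum>y\<in>range u. if u w = y then F y else 0)"
      using assms(1,3) by (intro sum.mono_neutral_cong_left) (auto simp: indicator_def)
    then show "F (u w) = (\<Sum>y\<in>range u - {0}. F y * indicator (u -` {y}) w)"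
      using assms(1) by simp
  qed
  also have "\<dots> = (\<Sum>y\<in>range u - {0}. F y * emeasure M (u -` {y}))"
    using assms(2) by (subst nn_integral_sum) (auto simp: nn_integral_cmult_indicator)
  finally show ?thesis .
qed

lemma poisson_random_measure_measurable:
  assumes "poisson_random_measure \<Omega> N \<nu>"
  shows "N \<in> measurable \<Omega> bf_algebra"
  using assms by (simp add: poisson_random_measure_def)

lemma poisson_random_measure_boundedly_finite:
  assumes "poisson_random_measure \<Omega> N \<nu>" "\<omega> \<in> space \<Omega>"
  shows "N \<omega> \<in> boundedly_finite_measures"
  using measurable_space[OF poisson_random_measure_measurable[OF assms(1)] assms(2)] by simp

text \<open>This is the Poisson generating function E q ^ N(B) = exp (- (1 - q) \<nu>(B)) at q = exp
  (- c). The case \<open>c = \<infinity>\<close> is included: then q = 0, and 0 ^ 0 = 1 gives the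
  probability of N(B) = 0.\<close>

lemma poisson_laplace_set:
  assumes N: "poisson_random_measure \<Omega> N \<nu>" and B: "B \<in> sets borel" "bounded B"
  shows "(\<integral>\<omega>. exp_neg (c * emeasure (N \<omega>) B) \<partial>\<Omega>) = exp (- ((1 - exp_neg c) * measure \<nu> B))"
proof -
  interpret prob_space \<Omega>
    using N by (simp add: poisson_random_measure_def)
  define A where "A k = {\<omega>\<in>space \<Omega>. emeasure (N \<omega>) B = of_nat k}" for k
  let ?p = "exp_neg c" and ?l = "measure \<nu> B"
  have X [measurable]: "(\<lambda>\<omega>. emeasure (N \<omega>) B) \<in> borel_measurable \<Omega>"
    using poisson_random_measure_measurable[OF N] measurable_emeasure_bf_algebra[OF B(1)]
    by (rule measurable_compose)
  have A [measurable]: "A k \<in> sets \<Omega>" for k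
    unfolding A_def by measurable
  have pA: "prob (A k) = ?l ^ k / fact k * exp (- ?l)" for k
    using N B by (simp add: poisson_random_measure_def A_def)
  \<comment> \<open>Used twice: q = 1 gives the total Poisson mass, q = \<open>exp_neg c\<close> the
    generating function.\<close>
  have sums: "(\<lambda>k. (q * ?l) ^ k / fact k * exp (- ?l)) sums exp (- ((1 - q) * ?l))" for q
    using sums_mult2[OF exp_converges[of "q * ?l"], of "exp (- ?l)"]
    by (simp add: divide_inverse mult_ac exp_add[symmetric] algebra_simps)
  have "(\<lambda>k. prob (A k)) sums \<P>(\<omega> in \<Omega>. \<exists>k::nat. emeasure (N \<omega>) B = of_nat k)"
    unfolding A_def by (intro prob_sums) auto
  \<comment> \<open>The Poisson weights already add up to 1, so no mass is left for non-integer or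
    infinite values of N(B).\<close>
  moreover have "(\<lambda>k. prob (A k)) sums 1"
    using sums[of 1] by (simp add: pA)
  ultimately have "\<P>(\<omega> in \<Omega>. \<exists>k::nat. emeasure (N \<omega>) B = of_nat k) = 1"
    by (rule sums_unique2)
  then have AE: "AE \<omega> in \<Omega>. \<exists>k::nat. emeasure (N \<omega>) B = of_nat k"
    using AE_prob_1 by fastforce
  have "(\<integral>\<^sup>+ \<omega>. ennreal (exp_neg (c * emeasure (N \<omega>) B)) \<partial>\<Omega>)
      = (\<integral>\<^sup>+ \<omega>. (\<Sum>k. ennreal (?p ^ k) * indicator (A k) \<omega>) \<partial>\<Omega>)"
  proof (rule nn_integral_cong_AE)
    show "AE \<omega> in \<Omega>. ennreal (exp_neg (c * emeasure (N \<omega>) B))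
        = (\<Sum>k. ennreal (?p ^ k) * indicator (A k) \<omega>)"
      using AE AE_space
    proof eventually_elim
      fix \<omega> assume "\<exists>k::nat. emeasure (N \<omega>) B = of_nat k" and \<omega>: "\<omega> \<in> space \<Omega>"
      then obtain k :: nat where k: "emeasure (N \<omega>) B = of_nat k" by blast
      have "(\<Sum>j. ennreal (?p ^ j) * indicator (A j) \<omega>)
          = (\<Sum>j\<in>{k}. ennreal (?p ^ j) * indicator (A j) \<omega>)"
        by (intro suminf_finite) (auto simp: A_def k)
      with k \<omega> show "ennreal (exp_neg (c * emeasure (N \<omega>) B))
          = (\<Sum>j. ennreal (?p ^ j) * indicator (A j) \<omega>)"
        by (simp add: A_def exp_neg_of_nat_mult)
    qed
  qed
  also have "\<dots> = (\<Sum>k. ennreal (?p ^ k) * emeasure \<Omega> (A k))"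
    by (subst nn_integral_suminf) (simp_all add: nn_integral_cmult_indicator)
  also have "\<dots> = (\<Sum>k. ennreal ((?p * ?l) ^ k / fact k * exp (- ?l)))"
    by (intro arg_cong[where f = suminf] ext)
       (simp add: emeasure_eq_measure pA ennreal_mult[symmetric] power_mult_distrib mult_ac)
  also have "\<dots> = ennreal (exp (- ((1 - ?p) * ?l)))"
    by (intro suminf_ennreal_eq sums) simp
  finally show ?thesis
    by (subst integral_eq_nn_integral) auto
qed

text \<open>N(u) is a finite sum over the nonzero level sets of \<open>u\<close>. These are disjoint
  and bounded, so the terms are independent, the expectation factors, and each factor is given by
  \<open>poisson_laplace_set\<close>.\<close>

lemma poisson_laplace_simple:
  assumes N: "poisson_random_measure \<Omega> N \<nu>" and \<nu>: "\<nu> \<in> boundedly_finite_measures"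
    and u: "u \<in> borel_measurable borel" "finite (range u)" "bounded {w. u w \<noteq> 0}"
  shows "(\<integral>\<omega>. exp_neg (\<integral>\<^sup>+ w. u w \<partial>N \<omega>) \<partial>\<Omega>) = exp_neg (\<integral>\<^sup>+ w. ennreal (1 - exp_neg (u w)) \<partial>\<nu>)"
proof -
  interpret prob_space \<Omega>
    using N by (simp add: poisson_random_measure_def)
  \<comment> \<open>The nonzero values are numbered because independence in
    \<open>poisson_random_measure\<close> is stated for families over \<open>{..<n}\<close>. The
    value 0 is left out: its level set need not be bounded.\<close>
  obtain e and n :: nat where e: "bij_betw e {..<n} (range u - {0})"
    using ex_bij_betw_nat_finite[of "range u - {0}"] u(2) by (auto simp: atLeast0LessThan)
  define B where "B i = u -` {e i}" for i
  have level: "u -` {y} \<in> sets borel" for y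
    using measurable_sets[OF u(1), of "{y}"] by simp
  have e0: "e i \<noteq> 0" if "i < n" for i
    using bij_betwE[OF e] that by auto
  have B: "B i \<in> sets borel" "i < n \<Longrightarrow> bounded (B i)" for i
    using level e0 by (auto simp: B_def intro!: bounded_subset[OF u(3)])
  have disj: "disjoint_family_on B {..<n}"
    using bij_betw_imp_inj_on[OF e] by (auto simp: disjoint_family_on_def B_def inj_on_def)
  have int: "(\<integral>\<^sup>+ w. F (u w) \<partial>m) = (\<Sum>i<n. F (e i) * emeasure m (B i))"
    if "m \<in> boundedly_finite_measures" "F 0 = 0" for m and F :: "ennreal \<Rightarrow> ennreal"
    using nn_integral_finite_range[of u m F] u(2) level that
      sum.reindex_bij_betw[OF e, of "\<lambda>y. F y * emeasure m (u -` {y})", symmetric]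
    by (simp add: sets_boundedly_finite B_def)
  have fin: "emeasure \<nu> (B i) = ennreal (measure \<nu> (B i))" if "i < n" for i
    using \<nu> B that by (intro emeasure_eq_ennreal_measure) (fastforce simp: boundedly_finite_measures_def)
  have indep: "indep_vars (\<lambda>_. borel) (\<lambda>i \<omega>. exp_neg (e i * emeasure (N \<omega>) (B i))) {..<n}"
    using N B disj
    by (intro indep_vars_compose2[where Y = "\<lambda>i x. exp_neg (e i * x)" and M' = "\<lambda>_. borel"])
       (auto simp: poisson_random_measure_def)
  have "(\<integral>\<omega>. exp_neg (\<integral>\<^sup>+ w. u w \<partial>N \<omega>) \<partial>\<Omega>)
      = (\<integral>\<omega>. (\<Prod>i<n. exp_neg (e i * emeasure (N \<omega>) (B i))) \<partial>\<Omega>)"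
    using int[of _ "\<lambda>x. x"] poisson_random_measure_boundedly_finite[OF N]
    by (intro Bochner_Integration.integral_cong) (simp_all add: exp_neg_sum)
  also have "\<dots> = (\<Prod>i<n. \<integral>\<omega>. exp_neg (e i * emeasure (N \<omega>) (B i)) \<partial>\<Omega>)"
  proof (intro indep_vars_lebesgue_integral indep finite_lessThan)
    fix i assume "i \<in> {..<n}"
    then have "(\<lambda>\<omega>. exp_neg (e i * emeasure (N \<omega>) (B i))) \<in> borel_measurable \<Omega>"
      using indep by (auto simp: indep_vars_def)
    then show "integrable \<Omega> (\<lambda>\<omega>. exp_neg (e i * emeasure (N \<omega>) (B i)))"
      by (intro integrable_const_bound[where B = 1]) auto
  qed
  also have "\<dots> = (\<Prod>i<n. exp (- ((1 - exp_neg (e i)) * measure \<nu> (B i))))"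
    using B by (intro prod.cong poisson_laplace_set[OF N]) auto
  \<comment> \<open>Written through \<open>exp_neg\<close> again, the product becomes
    \<open>exp_neg\<close> of a sum, which \<open>int\<close> identifies with the integral.\<close>
  also have "\<dots> = (\<Prod>i<n. exp_neg (ennreal (1 - exp_neg (e i)) * emeasure \<nu> (B i)))"
    by (intro prod.cong) (simp_all add: fin ennreal_mult[symmetric])
  also have "\<dots> = exp_neg (\<integral>\<^sup>+ w. ennreal (1 - exp_neg (u w)) \<partial>\<nu>)"
    using int[OF \<nu>, of "\<lambda>y. ennreal (1 - exp_neg y)"] by (simp add: exp_neg_sum)
  finally show ?thesis .
qed

text \<open>Simple functions of bounded support increase to \<open>u\<close>. Under N the inner
  integrals converge monotonically and the expectations by domination by 1; under \<nu> the
  functions 1 - exp (- U) increase as well.\<close>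

theorem poisson_laplace:
  fixes \<nu> :: "'w::polish_space measure"
  assumes N: "poisson_random_measure \<Omega> N \<nu>" and \<nu>: "\<nu> \<in> boundedly_finite_measures"
    and u: "u \<in> borel_measurable borel"
  shows "(\<integral>\<omega>. exp_neg (\<integral>\<^sup>+ w. u w \<partial>N \<omega>) \<partial>\<Omega>) = exp_neg (\<integral>\<^sup>+ w. ennreal (1 - exp_neg (u w)) \<partial>\<nu>)"
proof -
  interpret prob_space \<Omega>
    using N by (simp add: poisson_random_measure_def)
  obtain F where F: "\<And>i. simple_function borel (F i)" "incseq F" "\<And>x. (SUP i. F i x) = u x"
    using borel_measurable_implies_simple_function_sequence'[OF u] by metis
  \<comment> \<open>The cut-off on growing balls supplies bounded support. The centre
    \<open>undefined\<close> is just some point: every \<open>w\<close> lies in all sufficiently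
    large balls around it.\<close>
  define U :: "nat \<Rightarrow> 'w \<Rightarrow> ennreal" where
    "U i w = F i w * indicator (ball undefined (real i)) w" for i w
  have simple: "simple_function borel (U i)" for i
    unfolding U_def by (intro simple_function_mult F simple_function_indicator) auto
  then have meas: "U i \<in> borel_measurable borel" for i
    by (rule borel_measurable_simple_function)
  have fin: "finite (range (U i))" for i
    using simple[of i] by (simp add: simple_function_def)
  have bdd: "bounded {w. U i w \<noteq> 0}" for i
    by (rule bounded_subset[OF bounded_ball[of undefined "real i"]]) (auto simp: U_def indicator_def)
  have U_mono: "U i w \<le> U j w" if "i \<le> j" for i j w
  proof -
    have "indicator (ball undefined (real i)) w \<le> (indicator (ball undefined (real j)) w :: ennreal)"
      using that by (auto simp: indicator_def)
    then show ?thesis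
      unfolding U_def using F(2) that by (intro mult_mono) (auto simp: incseq_def le_fun_def)
  qed
  have U_lim: "(\<lambda>i. U i w) \<longlonglongrightarrow> u w" for w
  proof (rule Lim_transform_eventually)
    show "(\<lambda>i. F i w) \<longlonglongrightarrow> u w"
      using LIMSEQ_SUP[of "\<lambda>i. F i w"] F(2,3) by (simp add: incseq_def le_fun_def)
    obtain k :: nat where "dist undefined w < real k"
      using reals_Archimedean2 by blast
    then have "F i w = U i w" if "i \<ge> k" for i
      using that by (simp add: U_def)
    then show "\<forall>\<^sub>F i in sequentially. F i w = U i w"
      by (auto simp: eventually_sequentially)
  qed
  have rv: "(\<lambda>\<omega>. exp_neg (\<integral>\<^sup>+ w. v w \<partial>N \<omega>)) \<in> borel_measurable \<Omega>" if "v \<in> borel_measurable borel" for v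
    using measurable_compose[OF poisson_random_measure_measurable[OF N]
        measurable_nn_integral_bf_algebra[OF that]] by measurable
  have "(\<lambda>i. \<integral>\<omega>. exp_neg (\<integral>\<^sup>+ w. U i w \<partial>N \<omega>) \<partial>\<Omega>) \<longlonglongrightarrow> (\<integral>\<omega>. exp_neg (\<integral>\<^sup>+ w. u w \<partial>N \<omega>) \<partial>\<Omega>)"
  proof (rule integral_dominated_convergence[where w = "\<lambda>_. 1"])
    show "AE \<omega> in \<Omega>. (\<lambda>i. exp_neg (\<integral>\<^sup>+ w. U i w \<partial>N \<omega>)) \<longlonglongrightarrow> exp_neg (\<integral>\<^sup>+ w. u w \<partial>N \<omega>)"
      using U_mono U_lim meas poisson_random_measure_boundedly_finite[OF N]
      by (intro AE_I2 tendsto_exp_neg nn_integral_LIMSEQ)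
         (auto simp: incseq_def le_fun_def borel_measurable_boundedly_finite)
  qed (auto intro: rv u meas)
  moreover have "(\<lambda>i. exp_neg (\<integral>\<^sup>+ w. ennreal (1 - exp_neg (U i w)) \<partial>\<nu>))
      \<longlonglongrightarrow> exp_neg (\<integral>\<^sup>+ w. ennreal (1 - exp_neg (u w)) \<partial>\<nu>)"
  proof (intro tendsto_exp_neg nn_integral_LIMSEQ)
    show "incseq (\<lambda>i w. ennreal (1 - exp_neg (U i w)))"
      using U_mono by (auto simp: incseq_def le_fun_def intro!: ennreal_leI exp_neg_antimono)
    show "(\<lambda>w. ennreal (1 - exp_neg (U i w))) \<in> borel_measurable \<nu>" for i
      using meas[of i] by (intro borel_measurable_boundedly_finite[OF \<nu>]) measurable
    show "(\<lambda>i. ennreal (1 - exp_neg (U i w))) \<longlonglongrightarrow> ennreal (1 - exp_neg (u w))" for w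
      by (intro tendsto_ennrealI tendsto_diff tendsto_const tendsto_exp_neg U_lim)
  qed
  ultimately show ?thesis
    using poisson_laplace_simple[OF N \<nu> meas fin bdd] by (simp add: LIMSEQ_unique)
qed

section \<open>Uniqueness of finite measures with a given Laplace functional\<close>

text \<open>
  The exponent \<open>k n \<approx> n exp (n a)\<close> makes \<open>k n * exp (- n y)\<close> tend to \<open>0\<close> for \<open>y > a\<close> and to \<open>\<infinity>\<close> for
  \<open>y \<le> a\<close>; the extra factor \<open>n\<close> settles the case \<open>y = a\<close>.
\<close>
lemma exp_neg_power_tendsto_indicator:
  fixes y :: ennreal and a :: real
  assumes "0 \<le> a"
  shows "(\<lambda>n. (1 - exp_neg (of_nat n * y)) ^ nat \<lceil>real n * exp (real n * a)\<rceil>)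
           \<longlonglongrightarrow> indicator {ennreal a<..} y"
proof (cases y)
  case top
  \<comment> \<open>For n > 0 the product \<open>of_nat n * y\<close> is \<infinity> and the base is
    1; n = 0 is set aside because there the product is 0.\<close>
  have "eventually (\<lambda>n. 1 = (1 - exp_neg (of_nat n * y)) ^ nat \<lceil>real n * exp (real n * a)\<rceil>) sequentially"
    using eventually_gt_at_top[of 0] by eventually_elim (simp add: top ennreal_mult_top)
  then show ?thesis
    using Lim_transform_eventually[OF tendsto_const[of "1 :: real"]] by (simp add: top)
next
  case (real r)
  define k where "k n = nat \<lceil>real n * exp (real n * a)\<rceil>" for n
  have E: "exp_neg (of_nat n * y) = exp (- (real n * r))" for n
    using real by (simp add: ennreal_of_nat_eq_real_of_nat ennreal_mult[symmetric])
  have x: "exp (- (real n * r)) \<le> 1" for n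
    using real by simp
  have k_ge: "real n * exp (real n * a) \<le> real (k n)" for n
    by (simp add: k_def)
  have k_le: "real (k n) \<le> real n * exp (real n * a) + 1" for n
    by (simp add: k_def)
  have "(\<lambda>n. (1 - exp (- (real n * r))) ^ k n) \<longlonglongrightarrow> indicator {ennreal a<..} y"
  proof (cases "a < r")
    case True
    define d where "d = r - a"
    have d: "0 < d" "0 < r" using True assms by (auto simp: d_def)
    \<comment> \<open>Bernoulli's inequality (1 - x) ^ k \<ge> 1 - k x, where \<open>k_le\<close>
      bounds k x. The second summand is the cost of rounding up.\<close>
    have lower: "1 - (real n * exp (- (real n * d)) + exp (- (real n * r))) \<le> (1 - exp (- (real n * r))) ^ k n" for n
    proof -
      have "real (k n) * exp (- (real n * r)) \<le> (real n * exp (real n * a) + 1) * exp (- (real n * r))"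
        by (intro mult_right_mono k_le) simp
      also have "\<dots> = real n * exp (- (real n * d)) + exp (- (real n * r))"
        by (simp add: d_def algebra_simps exp_add[symmetric] flip: mult.assoc)
      finally show ?thesis
        using Bernoulli_inequality[of "- exp (- (real n * r))" "k n"] x[of n] by simp
    qed
    have "(\<lambda>n. 1 - (real n * exp (- d) ^ n + exp (- r) ^ n)) \<longlonglongrightarrow> 1 - (0 + 0)"
      using d by (intro tendsto_diff tendsto_add tendsto_const powser_times_n_limit_0 LIMSEQ_power_zero) auto
    then have lim: "(\<lambda>n. 1 - (real n * exp (- (real n * d)) + exp (- (real n * r)))) \<longlonglongrightarrow> 1"
      by (simp add: exp_of_nat_mult[symmetric])
    have upper: "(1 - exp (- (real n * r))) ^ k n \<le> 1" for n
      using x by (intro power_le_one) auto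
    have "(\<lambda>n. (1 - exp (- (real n * r))) ^ k n) \<longlonglongrightarrow> 1"
      by (rule real_tendsto_sandwich[OF _ _ lim tendsto_const]) (simp_all add: lower upper)
    then show ?thesis
      using True real assms by (simp add: ennreal_less_iff)
  next
    case False
    \<comment> \<open>From 1 - x \<le> exp (- x) the power is at most exp (- k x), and r \<le> a
      gives k x \<ge> n.\<close>
    have upper: "(1 - exp (- (real n * r))) ^ k n \<le> exp (- real n)" for n
    proof -
      have "real n \<le> real n * exp (real n * a - real n * r)"
        using False mult_left_mono[of 1 "exp (real n * a - real n * r)" "real n"]
        by (simp add: mult_left_mono)
      also have "\<dots> = real n * exp (real n * a) * exp (- (real n * r))"
        by (simp add: exp_add[symmetric])
      also have "\<dots> \<le> real (k n) * exp (- (real n * r))"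
        by (intro mult_right_mono k_ge) simp
      finally have n: "real n \<le> real (k n) * exp (- (real n * r))" .
      have "(1 - exp (- (real n * r))) ^ k n \<le> exp (- exp (- (real n * r))) ^ k n"
        using x exp_ge_add_one_self[of "- exp (- (real n * r))"] by (intro power_mono) auto
      also have "\<dots> = exp (- (real (k n) * exp (- (real n * r))))"
        by (simp add: exp_of_nat_mult[symmetric])
      also have "\<dots> \<le> exp (- real n)"
        using n by simp
      finally show ?thesis .
    qed
    have "(\<lambda>n. exp (- 1 :: real) ^ n) \<longlonglongrightarrow> 0"
      by (intro LIMSEQ_power_zero) simp
    then have lim: "(\<lambda>n. exp (- real n)) \<longlonglongrightarrow> 0"
      by (simp add: exp_of_nat_mult[symmetric])
    have lower: "0 \<le> (1 - exp (- (real n * r))) ^ k n" for n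
      using x by simp
    have "(\<lambda>n. (1 - exp (- (real n * r))) ^ k n) \<longlonglongrightarrow> 0"
      by (rule real_tendsto_sandwich[OF _ _ tendsto_const lim]) (simp_all add: lower upper)
    then show ?thesis
      using False real assms by (simp add: ennreal_less_iff)
  qed
  then show ?thesis by (simp add: E k_def)
qed

lemma sets_bf_algebra_generator:
  "sets (bf_algebra :: 'w::polish_space measure measure) = sigma_sets boundedly_finite_measures
     {{m\<in>boundedly_finite_measures. \<forall>(B, a)\<in>I. a < emeasure m B} | I.
        finite I \<and> I \<subseteq> sets borel \<times> UNIV}"
    (is "_ = sigma_sets ?S ?G")
proof
  have sub: "?G \<subseteq> Pow ?S" by auto
  have "{m\<in>?S. emeasure m B \<in> A} \<in> sigma_sets ?S ?G"
    if [measurable]: "B \<in> sets borel" "A \<in> sets borel" for B :: "'w set" and A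
  proof -
    have "(\<lambda>m. emeasure m B) \<in> borel_measurable (sigma ?S ?G)"
    proof (rule borel_measurableI_greater)
      fix y
      have "{m\<in>?S. \<forall>(B', a)\<in>{(B, y)}. a < emeasure m B'} \<in> ?G"
        using that by blast
      then show "{m \<in> space (sigma ?S ?G). y < emeasure m B} \<in> sets (sigma ?S ?G)"
        using sub by (simp add: space_measure_of sets_measure_of sigma_sets.Basic)
    qed
    from measurable_sets[OF this that(2)] show ?thesis
      using sub by (simp add: space_measure_of sets_measure_of vimage_def Int_def conj_commute)
  qed
  then have "{{m\<in>?S. emeasure m B \<in> A} | B A. B \<in> sets borel \<and> A \<in> sets borel}
      \<subseteq> sigma_sets ?S ?G" by blast
  then show "sets (bf_algebra :: 'w measure measure) \<subseteq> sigma_sets ?S ?G"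
    unfolding bf_algebra_def by (subst sets_measure_of) (auto intro!: sigma_sets_mono)
  have "?G \<subseteq> sets bf_algebra"
  proof clarify
    fix I :: "('w set \<times> ennreal) set" assume I: "finite I" "I \<subseteq> sets borel \<times> UNIV"
    have "{m\<in>space bf_algebra. \<forall>p\<in>I. snd p < emeasure m (fst p)} \<in> sets bf_algebra"
    proof (intro sets.sets_Collect_finite_All[OF _ I(1)])
      fix p assume "p \<in> I"
      then have [measurable]: "fst p \<in> sets borel" using I by auto
      show "{m\<in>space bf_algebra. snd p < emeasure m (fst p)} \<in> sets bf_algebra"
        by measurable
    qed
    then show "{m\<in>?S. \<forall>(B, a)\<in>I. a < emeasure m B} \<in> sets bf_algebra"
      by (simp add: case_prod_beta)
  qed
  then show "sigma_sets ?S ?G \<subseteq> sets bf_algebra"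
    using sets.sigma_sets_subset[of ?G bf_algebra] by simp
qed

text \<open>The class \<open>good\<close> contains 1 by hypothesis and is closed under
  multiplication by 1 - \<open>E v\<close>, hence by its powers, and through bounded limits by
  indicators of N(B) > a. Finite products of these are the indicators of the intersection-stable
  generator.\<close>

theorem laplace_functional_unique:
  fixes M1 M2 :: "'w::polish_space measure measure"
  assumes fin: "finite_measure M1" "finite_measure M2"
    and sets: "sets M1 = sets bf_algebra" "sets M2 = sets bf_algebra"
    and eq: "\<And>u. u \<in> borel_measurable borel \<Longrightarrow>
      (\<integral>m. exp_neg (\<integral>\<^sup>+ w. u w \<partial>m) \<partial>M1) = (\<integral>m. exp_neg (\<integral>\<^sup>+ w. u w \<partial>m) \<partial>M2)"
  shows "M1 = M2"
proof -
  define E :: "('w \<Rightarrow> ennreal) \<Rightarrow> 'w measure \<Rightarrow> real" where "E u m = exp_neg (\<integral>\<^sup>+ w. u w \<partial>m)" for u m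
  \<comment> \<open>The bounds 0 and 1 provide integrability here and the dominating constant in the
    limits below.\<close>
  define good :: "('w measure \<Rightarrow> real) \<Rightarrow> bool" where
    "good F \<longleftrightarrow> F \<in> borel_measurable bf_algebra \<and> (\<forall>m. 0 \<le> F m \<and> F m \<le> 1) \<and>
       (\<forall>u\<in>borel_measurable borel. (\<integral>m. F m * E u m \<partial>M1) = (\<integral>m. F m * E u m \<partial>M2))" for F
  define adm :: "'w measure measure \<Rightarrow> bool" where
    "adm M \<longleftrightarrow> finite_measure M \<and> sets M = sets bf_algebra" for M
  have adm: "adm M1" "adm M2"
    using fin sets by (simp_all add: adm_def)
  have space: "space M = boundedly_finite_measures" if "adm M" for M
    using that sets_eq_imp_space_eq[of M bf_algebra] by (simp add: adm_def)
  have E01: "0 \<le> E u m" "E u m \<le> 1" for u m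
    by (simp_all add: E_def)
  have E_meas [measurable]: "E u \<in> borel_measurable bf_algebra" if "u \<in> borel_measurable borel" for u
    unfolding E_def using measurable_nn_integral_bf_algebra[OF that] by measurable
  have meas: "F \<in> borel_measurable M"
    if "adm M" "F \<in> borel_measurable bf_algebra" for M and F :: "'w measure \<Rightarrow> real"
    using that by (simp cong: measurable_cong_sets add: adm_def)
  have E_add: "E (\<lambda>w. u w + v w) m = E u m * E v m"
    if "u \<in> borel_measurable borel" "v \<in> borel_measurable borel" "m \<in> boundedly_finite_measures" for u v m
    using that unfolding E_def by (simp add: nn_integral_add borel_measurable_boundedly_finite exp_neg_add)
  have int: "integrable M F"
    if "adm M" "F \<in> borel_measurable bf_algebra" "\<And>m. 0 \<le> F m \<and> F m \<le> 1" for M and F :: "'w measure \<Rightarrow> real"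
    using that meas[OF that(1,2)]
    by (intro finite_measure.integrable_const_bound[where B = 1]) (auto simp: adm_def)

  \<comment> \<open>Testing against all \<open>E u\<close>, not only against \<open>1\<close>, makes the induction over factors go through.\<close>
  have good_step: "good (\<lambda>m. F m * (1 - E v m))" if F: "good F" and v: "v \<in> borel_measurable borel" for F v
    unfolding good_def
  proof (intro conjI ballI allI)
    have [measurable]: "F \<in> borel_measurable bf_algebra" using F by (simp add: good_def)
    have [measurable]: "E v \<in> borel_measurable bf_algebra" by (rule E_meas[OF v])
    show "(\<lambda>m. F m * (1 - E v m)) \<in> borel_measurable bf_algebra" by measurable
    have F01: "0 \<le> F m" "F m \<le> 1" for m using F by (simp_all add: good_def)
    show "0 \<le> F m * (1 - E v m)" for m using F01 E01 by simp
    show "F m * (1 - E v m) \<le> 1" for m using F01 E01[of v m] by (intro mult_le_one) auto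
    fix u :: "'w \<Rightarrow> ennreal" assume u: "u \<in> borel_measurable borel"
    have uv: "(\<lambda>w. v w + u w) \<in> borel_measurable borel" using u v by measurable
    \<comment> \<open>Since \<open>E v m * E u m\<close> is \<open>E\<close> at the sum of
      \<open>v\<close> and \<open>u\<close>, expanding the product leaves two integrals of
      \<open>F\<close> against functions \<open>E\<close>, both covered by
      \<open>good F\<close>.\<close>
    have "(\<integral>m. F m * (1 - E v m) * E u m \<partial>M) = (\<integral>m. F m * E u m \<partial>M) - (\<integral>m. F m * E (\<lambda>w. v w + u w) m \<partial>M)"
      if M: "adm M" for M
    proof -
      have "integrable M (\<lambda>m. F m * E u' m)" if "u' \<in> borel_measurable borel" for u'
      proof (rule int[OF M])
        show "(\<lambda>m. F m * E u' m) \<in> borel_measurable bf_algebra"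
          using E_meas[OF that] by measurable
        show "0 \<le> F m * E u' m \<and> F m * E u' m \<le> 1" for m
          using F01[of m] E01[of u' m] by (simp add: mult_le_one)
      qed
      note this[OF u] this[OF uv]
      then have "(\<integral>m. F m * E u m \<partial>M) - (\<integral>m. F m * E (\<lambda>w. v w + u w) m \<partial>M)
          = (\<integral>m. F m * E u m - F m * E (\<lambda>w. v w + u w) m \<partial>M)"
        by simp
      also have "\<dots> = (\<integral>m. F m * (1 - E v m) * E u m \<partial>M)"
        using space[OF M] by (intro Bochner_Integration.integral_cong) (simp_all add: E_add u v algebra_simps)
      finally show ?thesis by simp
    qed
    from this[OF adm(1)] this[OF adm(2)]
    show "(\<integral>m. F m * (1 - E v m) * E u m \<partial>M1) = (\<integral>m. F m * (1 - E v m) * E u m \<partial>M2)"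
      using F u uv by (simp add: good_def)
  qed

  have good_power: "good (\<lambda>m. F m * (1 - E v m) ^ k)" if "good F" "v \<in> borel_measurable borel" for F v k
  proof (induction k)
    case (Suc k)
    from good_step[OF this that(2)] show ?case by (simp add: mult_ac)
  qed (use that in simp)

  have good_indicator: "good (\<lambda>m. F m * indicator {m. a < emeasure m B} m)"
    if F: "good F" and B: "B \<in> sets borel" for F B and a :: ennreal
  proof -
    have [measurable]: "F \<in> borel_measurable bf_algebra" using F by (simp add: good_def)
    have F01: "0 \<le> F m" "F m \<le> 1" for m using F by (simp_all add: good_def)
    have ind [measurable]: "(\<lambda>m. F m * indicator {m. a < emeasure m B} m) \<in> borel_measurable bf_algebra"
    proof -
      have [measurable]: "(\<lambda>m. emeasure m B) \<in> borel_measurable bf_algebra"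
        by (rule measurable_emeasure_bf_algebra[OF B])
      have "(\<lambda>m. F m * indicator {a<..} (emeasure m B)) \<in> borel_measurable bf_algebra"
        by measurable
      then show ?thesis by (simp add: indicator_def)
    qed
    have "(\<integral>m. F m * indicator {m. a < emeasure m B} m * E u m \<partial>M1)
        = (\<integral>m. F m * indicator {m. a < emeasure m B} m * E u m \<partial>M2)"
      if u: "u \<in> borel_measurable borel" for u
    proof (cases a)
      case (real r)
      \<comment> \<open>With \<open>v n\<close> equal to n on \<open>B\<close>, the value
        \<open>E (v n) m\<close> is exp (- n m(B)), so the powers \<open>k n\<close> are those of
        \<open>exp_neg_power_tendsto_indicator\<close>.\<close>
      define k where "k n = nat \<lceil>real n * exp (real n * r)\<rceil>" for n
      define v :: "nat \<Rightarrow> 'w \<Rightarrow> ennreal" where "v n w = of_nat n * indicator B w" for n w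
      have v: "v n \<in> borel_measurable borel" for n unfolding v_def using B by measurable
      have Ev: "E (v n) m = exp_neg (of_nat n * emeasure m B)" if "m \<in> boundedly_finite_measures" for n m
        using that B by (simp add: E_def v_def nn_integral_cmult_indicator sets_boundedly_finite)
      have lim: "(\<lambda>n. \<integral>m. F m * (1 - E (v n) m) ^ k n * E u m \<partial>M)
          \<longlonglongrightarrow> (\<integral>m. F m * indicator {m. a < emeasure m B} m * E u m \<partial>M)"
        if M: "adm M" for M
      proof (rule integral_dominated_convergence[where w = "\<lambda>_. 1"])
        show "(\<lambda>m. F m * indicator {m. a < emeasure m B} m * E u m) \<in> borel_measurable M"
          by (intro meas[OF M] borel_measurable_times ind E_meas u)
        show "(\<lambda>m. F m * (1 - E (v n) m) ^ k n * E u m) \<in> borel_measurable M" for n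
          using E_meas[OF u] E_meas[OF v[of n]] v[of n] by (intro meas[OF M]) measurable
        show "integrable M (\<lambda>_. 1 :: real)"
          using M by (simp add: adm_def finite_measure.integrable_const)
        show "AE m in M. norm (F m * (1 - E (v n) m) ^ k n * E u m) \<le> 1" for n
          using F01 E01 by (intro AE_I2) (auto simp: abs_mult intro!: mult_le_one power_le_one)
        show "AE m in M. (\<lambda>n. F m * (1 - E (v n) m) ^ k n * E u m)
            \<longlonglongrightarrow> F m * indicator {m. a < emeasure m B} m * E u m"
        proof (intro AE_I2 tendsto_mult tendsto_const)
          fix m assume "m \<in> space M"
          then show "(\<lambda>n. (1 - E (v n) m) ^ k n) \<longlonglongrightarrow> indicator {m. a < emeasure m B} m"
            using exp_neg_power_tendsto_indicator[of r "emeasure m B"] real space[OF M]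
            by (simp add: Ev k_def indicator_def)
        qed
      qed
      have "(\<integral>m. F m * (1 - E (v n) m) ^ k n * E u m \<partial>M1)
          = (\<integral>m. F m * (1 - E (v n) m) ^ k n * E u m \<partial>M2)" for n
        using good_power[OF F v, of n "k n"] u by (simp add: good_def)
      with lim[OF adm(1)] lim[OF adm(2)]
      show ?thesis by (simp add: LIMSEQ_unique)
    \<comment> \<open>For \<open>a\<close> = \<infinity> no value exceeds \<open>a\<close>, and both
      integrals vanish.\<close>
    qed simp
    then show ?thesis
      using ind F01 by (auto simp: good_def indicator_def)
  qed

  have good_prod: "good (\<lambda>m. \<Prod>p\<in>I. indicator {m. snd p < emeasure m (fst p)} m)"
    if "finite I" "I \<subseteq> sets borel \<times> UNIV" for I :: "('w set \<times> ennreal) set"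
    using that
  proof induction
    \<comment> \<open>The empty product is 1, for which \<open>good\<close> is exactly the assumed
      equality of Laplace functionals.\<close>
    case empty
    then show ?case using eq by (simp add: good_def E_def)
  next
    case (insert p I)
    then show ?case
      using good_indicator[of "\<lambda>m. \<Prod>p\<in>I. indicator {m. snd p < emeasure m (fst p)} m" "fst p" "snd p"]
      by (auto simp: mult.commute)
  qed

  let ?G = "{{m\<in>boundedly_finite_measures. \<forall>(B, a)\<in>I. a < emeasure m B} | I.
        finite I \<and> I \<subseteq> sets (borel :: 'w measure) \<times> UNIV}"
  show ?thesis
  proof (rule measure_eqI_generator_eq[where A = "\<lambda>_. boundedly_finite_measures"])
    show "Int_stable ?G"
    proof (rule Int_stableI)
      fix X Y assume "X \<in> ?G" "Y \<in> ?G"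
      then obtain I J where
        "X = {m\<in>boundedly_finite_measures. \<forall>(B, a)\<in>I. a < emeasure m B}" "finite I" "I \<subseteq> sets borel \<times> UNIV"
        "Y = {m\<in>boundedly_finite_measures. \<forall>(B, a)\<in>J. a < emeasure m B}" "finite J" "J \<subseteq> sets borel \<times> UNIV"
        by blast
      then show "X \<inter> Y \<in> ?G"
        by (intro CollectI exI[of _ "I \<union> J"]) auto
    qed
    show "?G \<subseteq> Pow boundedly_finite_measures" by auto
    show "sets M1 = sigma_sets boundedly_finite_measures ?G" "sets M2 = sigma_sets boundedly_finite_measures ?G"
      using sets sets_bf_algebra_generator by auto
    \<comment> \<open>The empty index set puts the whole space into the generator, so a constant
      sequence is an exhaustion by sets of finite mass.\<close>
    have "boundedly_finite_measures = {m\<in>boundedly_finite_measures. \<forall>(B, a)\<in>{} :: ('w set \<times> ennreal) set. a < emeasure m B}"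
      by simp
    then show "range (\<lambda>_::nat. boundedly_finite_measures) \<subseteq> ?G" by blast
    show "emeasure M1 boundedly_finite_measures \<noteq> \<infinity>"
      using finite_measure.emeasure_finite[OF fin(1)] by simp
    fix X assume "X \<in> ?G"
    then obtain I where X: "X = {m\<in>boundedly_finite_measures. \<forall>(B, a)\<in>I. a < emeasure m B}"
      and I: "finite I" "I \<subseteq> sets borel \<times> UNIV" by blast
    have "X \<in> sets bf_algebra"
      using \<open>X \<in> ?G\<close> by (auto simp: sets_bf_algebra_generator intro: sigma_sets.Basic)
    then have XM: "X \<in> sets M1" "X \<in> sets M2" by (simp_all add: sets)
    \<comment> \<open>Testing against u = 0, where \<open>E\<close> is 1, turns the equality in
      \<open>good\<close> into one of measures of \<open>X\<close>.\<close>
    have "measure M X = (\<integral>m. (\<Prod>p\<in>I. indicator {m. snd p < emeasure m (fst p)} m) * E (\<lambda>_. 0) m \<partial>M)"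
      if "space M = boundedly_finite_measures" "X \<in> sets M" for M
    proof -
      have "(\<Prod>p\<in>I. indicator {m. snd p < emeasure m (fst p)} m) * E (\<lambda>_. 0) m = indicator X m"
        if "m \<in> boundedly_finite_measures" for m
        using I that by (auto simp: X case_prod_beta E_def indicator_def prod_zero_iff split: if_splits intro!: prod.neutral)
      then have "(\<integral>m. (\<Prod>p\<in>I. indicator {m. snd p < emeasure m (fst p)} m) * E (\<lambda>_. 0) m \<partial>M)
          = (\<integral>m. indicator X m \<partial>M)"
        using that by (intro Bochner_Integration.integral_cong) auto
      then show ?thesis using that(2) by simp
    qed
    from this[OF space[OF adm(1)] XM(1)] this[OF space[OF adm(2)] XM(2)] good_prod[OF I]
    have "measure M1 X = measure M2 X"
      by (simp add: good_def)
    then show "emeasure M1 X = emeasure M2 X"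
      using fin by (simp add: finite_measure.emeasure_eq_measure)
  qed simp
qed

section \<open>Exponential change of measure for the Poisson law\<close>

lemma density_boundedly_finite:
  assumes \<nu>: "\<nu> \<in> boundedly_finite_measures" and h: "h \<in> borel_measurable borel" "\<And>w. h w \<le> 1"
  shows "density \<nu> h \<in> boundedly_finite_measures"
proof -
  have "emeasure (density \<nu> h) B < \<infinity>" if B: "B \<in> sets borel" "bounded B" for B
  proof -
    have "emeasure (density \<nu> h) B = (\<integral>\<^sup>+ w. h w * indicator B w \<partial>\<nu>)"
      using B h(1) \<nu> by (intro emeasure_density) (simp_all add: sets_boundedly_finite borel_measurable_boundedly_finite)
    also have "\<dots> \<le> (\<integral>\<^sup>+ w. indicator B w \<partial>\<nu>)"
      using h(2) by (intro nn_integral_mono) (auto simp: indicator_def)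
    also have "\<dots> < \<infinity>"
      using B \<nu> by (simp add: sets_boundedly_finite) (simp add: boundedly_finite_measures_def)
    finally show ?thesis .
  qed
  with \<nu> show ?thesis by (simp add: boundedly_finite_measures_def)
qed

text \<open>The integrand is at most the indicator of the support of \<open>f\<close>, a bounded
  Borel set. This reduces the case of bounded support to the integrability condition.\<close>

lemma BM_plus_nn_integral_finite:
  assumes \<nu>: "\<nu> \<in> boundedly_finite_measures" and f: "f \<in> BM_plus"
  shows "(\<integral>\<^sup>+ w. ennreal (1 - exp (- f w)) \<partial>\<nu>) < \<infinity>"
proof -
  have f_meas [measurable]: "f \<in> borel_measurable borel" and f_bdd: "bounded {w. f w \<noteq> 0}"
    using f by (simp_all add: BM_plus_def)
  have supp: "{w. f w \<noteq> 0} \<in> sets borel" by measurable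
  have "(\<integral>\<^sup>+ w. ennreal (1 - exp (- f w)) \<partial>\<nu>) \<le> (\<integral>\<^sup>+ w. indicator {w. f w \<noteq> 0} w \<partial>\<nu>)"
    by (intro nn_integral_mono) (auto simp: indicator_def)
  also have "\<dots> < \<infinity>"
    using supp f_bdd \<nu> by (simp add: sets_boundedly_finite) (simp add: boundedly_finite_measures_def)
  finally show ?thesis .
qed

text \<open>Both sides have the same Laplace functional. An infinite exponent is covered too:
  \<open>exp_neg\<close> is then 0 and both measures are null.\<close>

theorem poisson_change_of_measure:
  fixes \<nu> :: "'w::polish_space measure"
  assumes \<nu>: "\<nu> \<in> boundedly_finite_measures"
    and f: "f \<in> borel_measurable borel" "\<And>w. 0 \<le> f w"
    and P: "poisson_law \<nu> P" and Q: "poisson_law (density \<nu> (\<lambda>w. ennreal (exp (- f w)))) Q"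
  shows "density P (\<lambda>N. ennreal (exp_neg_integral f N))
    = scale_measure (ennreal (exp_neg (\<integral>\<^sup>+ w. ennreal (1 - exp (- f w)) \<partial>\<nu>))) Q"
    (is "?M1 = scale_measure (ennreal ?L) Q")
proof (rule laplace_functional_unique)
  let ?\<nu>f = "density \<nu> (\<lambda>w. ennreal (exp (- f w)))"
  note [measurable] = f(1)
  have P': "poisson_random_measure P (\<lambda>N. N) \<nu>" and setsP: "sets P = sets bf_algebra"
    and Q': "poisson_random_measure Q (\<lambda>N. N) ?\<nu>f" and setsQ: "sets Q = sets bf_algebra"
    using P Q by (auto simp: poisson_law_def)
  interpret P: prob_space P using P' by (simp add: poisson_random_measure_def)
  interpret Q: prob_space Q using Q' by (simp add: poisson_random_measure_def)
  have spaceP: "space P = boundedly_finite_measures"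
    using sets_eq_imp_space_eq[OF setsP] by simp
  have \<nu>f: "?\<nu>f \<in> boundedly_finite_measures"
    by (intro density_boundedly_finite[OF \<nu>]) (use f in auto)
  have rv: "(\<lambda>N. exp_neg (\<integral>\<^sup>+ w. u w \<partial>N)) \<in> borel_measurable M"
    if "u \<in> borel_measurable borel" "sets M = sets bf_algebra" for u and M :: "'w measure measure"
    using measurable_nn_integral_bf_algebra[OF that(1)]
    by (simp cong: measurable_cong_sets add: that(2)) measurable
  have Ef: "exp_neg_integral f \<in> borel_measurable P"
    using rv[OF _ setsP, of "\<lambda>w. ennreal (f w)"] by (simp add: exp_neg_integral_eq[abs_def])
  show "sets ?M1 = sets bf_algebra" "sets (scale_measure (ennreal ?L) Q) = sets bf_algebra"
    by (simp_all add: setsP setsQ)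
  show "finite_measure (scale_measure (ennreal ?L) Q)"
    by (intro finite_measureI) (simp add: space_scale_measure Q.emeasure_space_1)
  have "emeasure ?M1 (space P) = (\<integral>\<^sup>+ N. ennreal (exp_neg_integral f N) * indicator (space P) N \<partial>P)"
    using Ef by (intro emeasure_density) auto
  also have "\<dots> \<le> (\<integral>\<^sup>+ N. 1 \<partial>P)"
    by (intro nn_integral_mono) (auto simp: indicator_def exp_neg_integral_bounds)
  finally show "finite_measure ?M1"
    by (intro finite_measureI) (auto simp: P.emeasure_space_1 top_unique)
  fix u :: "'w \<Rightarrow> ennreal" assume u [measurable]: "u \<in> borel_measurable borel"
  have "(\<integral>N. exp_neg (\<integral>\<^sup>+ w. u w \<partial>N) \<partial>?M1) = (\<integral>N. exp_neg_integral f N * exp_neg (\<integral>\<^sup>+ w. u w \<partial>N) \<partial>P)"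
    using Ef rv[OF u setsP] by (subst integral_real_density) (auto simp: exp_neg_integral_eq)
  \<comment> \<open>The factor exp (- N(f)) is absorbed by passing to the Laplace functional at f +
    u.\<close>
  also have "\<dots> = (\<integral>N. exp_neg (\<integral>\<^sup>+ w. ennreal (f w) + u w \<partial>N) \<partial>P)"
    by (intro Bochner_Integration.integral_cong)
       (simp_all add: spaceP exp_neg_integral_eq nn_integral_add borel_measurable_boundedly_finite exp_neg_add)
  also have "\<dots> = exp_neg (\<integral>\<^sup>+ w. ennreal (1 - exp_neg (ennreal (f w) + u w)) \<partial>\<nu>)"
    by (intro poisson_laplace[OF P' \<nu>]) measurable
  also have "(\<integral>\<^sup>+ w. ennreal (1 - exp_neg (ennreal (f w) + u w)) \<partial>\<nu>)
      = (\<integral>\<^sup>+ w. ennreal (1 - exp (- f w)) + ennreal (exp (- f w)) * ennreal (1 - exp_neg (u w)) \<partial>\<nu>)"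
    using f(2)
    by (intro nn_integral_cong)
       (simp add: exp_neg_add ennreal_mult[symmetric] ennreal_plus[symmetric] algebra_simps del: ennreal_plus)
  \<comment> \<open>The weight exp (- f) moves into the intensity, so the second integral is the
    Laplace exponent of \<open>u\<close> under \<open>Q\<close>.\<close>
  also have "\<dots> = (\<integral>\<^sup>+ w. ennreal (1 - exp (- f w)) \<partial>\<nu>) + (\<integral>\<^sup>+ w. ennreal (1 - exp_neg (u w)) \<partial>?\<nu>f)"
    by (simp add: nn_integral_add nn_integral_density borel_measurable_boundedly_finite[OF \<nu>])
  also have "exp_neg \<dots> = ?L * (\<integral>N. exp_neg (\<integral>\<^sup>+ w. u w \<partial>N) \<partial>Q)"
    by (simp add: exp_neg_add poisson_laplace[OF Q' \<nu>f u])
  also have "\<dots> = (\<integral>N. exp_neg (\<integral>\<^sup>+ w. u w \<partial>N) \<partial>scale_measure (ennreal ?L) Q)"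
    using rv[OF u setsQ]
    by (simp add: integral_eq_nn_integral nn_integral_scale_measure enn2real_mult cong: measurable_cong_sets)
  finally show "(\<integral>N. exp_neg (\<integral>\<^sup>+ w. u w \<partial>N) \<partial>?M1)
      = (\<integral>N. exp_neg (\<integral>\<^sup>+ w. u w \<partial>N) \<partial>scale_measure (ennreal ?L) Q)" .
qed

section \<open>Integrals of g under the two Poisson laws\<close>

text \<open>Makes the density rules for Bochner integrals and integrability available for the scaled
  law.\<close>

lemma scale_measure_eq_density: "scale_measure c M = density M (\<lambda>_. c)"
  by (intro measure_eqI) (simp_all add: emeasure_density nn_integral_cmult_indicator)


theorem proposition2p1:
  fixes \<nu> :: "'w::polish_space measure"
    and P Q :: "'w measure measure"
    and f :: "'w \<Rightarrow> real"
  assumes "\<nu> \<in> boundedly_finite_measures"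
    and "sigma_finite_measure \<nu>"
    and "nonatomic \<nu>"
    and "f \<in> BM_plus \<or>
         (f \<in> borel_measurable borel \<and> (\<forall>w. 0 \<le> f w) \<and>
          (\<integral>\<^sup>+ w. ennreal (1 - exp (- f w)) \<partial>\<nu>) < \<infinity>)"
    and "poisson_law \<nu> P"
    and "poisson_law (density \<nu> (\<lambda>w. ennreal (exp (- f w)))) Q"
  shows "laplace_functional P f = exp (- (\<integral>w. 1 - exp (- f w) \<partial>\<nu>)) \<and>
    (\<forall>g :: 'w measure \<Rightarrow> ennreal. g \<in> borel_measurable bf_algebra \<longrightarrow>
       (\<integral>\<^sup>+ N. g N * ennreal (exp_neg_integral f N) \<partial>P)
         = ennreal (laplace_functional P f) * (\<integral>\<^sup>+ N. g N \<partial>Q)) \<and>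
    (\<forall>g :: 'w measure \<Rightarrow> real. g \<in> borel_measurable bf_algebra \<and> (integrable P g \<or> integrable Q g) \<longrightarrow>
       integrable P (\<lambda>N. g N * exp_neg_integral f N) \<and> integrable Q g \<and>
       (\<integral>N. g N * exp_neg_integral f N \<partial>P)
         = laplace_functional P f * (\<integral>N. g N \<partial>Q)) \<and>
    density P (\<lambda>N. ennreal (exp_neg_integral f N))
      = scale_measure (ennreal (laplace_functional P f)) Q"
proof -
  have f: "f \<in> borel_measurable borel" "\<And>w. 0 \<le> f w"
    and fin: "(\<integral>\<^sup>+ w. ennreal (1 - exp (- f w)) \<partial>\<nu>) < \<infinity>"
    using assms(4) BM_plus_nn_integral_finite[OF assms(1)] by (auto simp: BM_plus_def)
  define L where "L = exp (- (\<integral>w. 1 - exp (- f w) \<partial>\<nu>))"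
  have "0 < L" by (simp add: L_def)
  have P: "poisson_random_measure P (\<lambda>N. N) \<nu>" "sets P = sets bf_algebra"
    and Q: "sets Q = sets bf_algebra"
    using assms(5,6) by (simp_all add: poisson_law_def)
  have "(\<lambda>w. 1 - exp (- f w)) \<in> borel_measurable \<nu>"
    using f(1) by (intro borel_measurable_boundedly_finite[OF assms(1)]) measurable
  then have "(\<integral>w. 1 - exp (- f w) \<partial>\<nu>) = enn2real (\<integral>\<^sup>+ w. ennreal (1 - exp (- f w)) \<partial>\<nu>)"
    using f(2) by (intro integral_eq_nn_integral) auto
  \<comment> \<open>Were the exponent infinite, its Bochner integral would be 0 and \<open>L\<close>
    would be 1 instead of 0; \<open>fin\<close> excludes this.\<close>
  then have L: "exp_neg (\<integral>\<^sup>+ w. ennreal (1 - exp (- f w)) \<partial>\<nu>) = L"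
    using fin by (simp add: exp_neg_def L_def)
  have laplace: "laplace_functional P f = L"
    using poisson_laplace[OF P(1) assms(1), of "\<lambda>w. ennreal (f w)"] f
    by (simp add: laplace_functional_def exp_neg_integral_eq L)
  have dens: "density P (\<lambda>N. ennreal (exp_neg_integral f N)) = scale_measure (ennreal L) Q"
    using poisson_change_of_measure[OF assms(1) f assms(5,6)] by (simp add: L)
  have E_meas: "exp_neg_integral f \<in> borel_measurable P"
    using measurable_nn_integral_bf_algebra[of "\<lambda>w. ennreal (f w)"] f(1)
    unfolding exp_neg_integral_eq[abs_def] by (simp cong: measurable_cong_sets add: P(2)) measurable
  have nn: "(\<integral>\<^sup>+ N. g N * ennreal (exp_neg_integral f N) \<partial>P) = ennreal L * (\<integral>\<^sup>+ N. g N \<partial>Q)"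
    if "g \<in> borel_measurable bf_algebra" for g
  proof -
    have g: "g \<in> borel_measurable P" "g \<in> borel_measurable Q"
      using that by (simp_all cong: measurable_cong_sets add: P(2) Q)
    have "(\<integral>\<^sup>+ N. g N * ennreal (exp_neg_integral f N) \<partial>P)
        = (\<integral>\<^sup>+ N. g N \<partial>density P (\<lambda>N. ennreal (exp_neg_integral f N)))"
      using E_meas g by (subst nn_integral_density) (auto simp: mult.commute exp_neg_integral_bounds)
    also have "\<dots> = ennreal L * (\<integral>\<^sup>+ N. g N \<partial>Q)"
      using g by (simp add: dens nn_integral_scale_measure)
    finally show ?thesis .
  qed
  have real: "integrable P (\<lambda>N. g N * exp_neg_integral f N) \<and> integrable Q g \<and>
       (\<integral>N. g N * exp_neg_integral f N \<partial>P) = L * (\<integral>N. g N \<partial>Q)"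
    if "g \<in> borel_measurable bf_algebra" and int: "integrable P g \<or> integrable Q g"
    for g :: "'w measure \<Rightarrow> real"
  proof -
    have g: "g \<in> borel_measurable P" "g \<in> borel_measurable Q"
      using that(1) by (simp_all cong: measurable_cong_sets add: P(2) Q)
    have scaled: "density P (\<lambda>N. ennreal (exp_neg_integral f N)) = density Q (\<lambda>_. ennreal L)"
      using dens by (simp add: scale_measure_eq_density)
    have "integrable P (\<lambda>N. g N * exp_neg_integral f N)
        \<longleftrightarrow> integrable (density P (\<lambda>N. ennreal (exp_neg_integral f N))) g"
      using E_meas g by (subst integrable_real_density) (auto simp: mult.commute exp_neg_integral_bounds)
    \<comment> \<open>A positive constant density does not change integrability; this is where
      \<open>0 < L\<close> matters.\<close>
    also have "\<dots> \<longleftrightarrow> integrable Q g"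
      unfolding scaled using g \<open>0 < L\<close> by (subst integrable_real_density) auto
    finally have iff: "integrable P (\<lambda>N. g N * exp_neg_integral f N) \<longleftrightarrow> integrable Q g" .
    \<comment> \<open>As exp (- N(f)) \<le> 1, integrability of \<open>g\<close> under
      \<open>P\<close> passes to the product and then by \<open>iff\<close> to
      \<open>Q\<close>.\<close>
    have "integrable P (\<lambda>N. g N * exp_neg_integral f N)" if "integrable P g"
      using E_meas g
      by (intro Bochner_Integration.integrable_bound[OF that]) (auto simp: abs_mult mult_left_le exp_neg_integral_bounds)
    with int iff have "integrable P (\<lambda>N. g N * exp_neg_integral f N)" "integrable Q g"
      by blast+
    moreover have "(\<integral>N. g N * exp_neg_integral f N \<partial>P)
        = (\<integral>N. g N \<partial>density P (\<lambda>N. ennreal (exp_neg_integral f N)))"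
      using E_meas g by (subst integral_real_density) (auto simp: mult.commute exp_neg_integral_bounds)
    moreover have "\<dots> = L * (\<integral>N. g N \<partial>Q)"
      unfolding scaled using g \<open>0 < L\<close> by (subst integral_real_density) auto
    ultimately show ?thesis by simp
  qed
  show ?thesis
    unfolding laplace using nn real dens by (auto simp: L_def)
qed

end
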